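(* Let $n\ge1$. There is a constant $C$ depending only on $n$ such that for every $0<\theta\le\frac12$ and every real $n\times n$ matrix $A$ with $\det A\ge\theta>0$, $$\frac{\theta}{C}\,\frac{1}{|A^{-1}|}\left|1-\frac{1}{\det A}\right|\le \operatorname{dist}(A,SL(n))\le C\,\frac{1}{|A^{-1}|}\left|1-\frac1{\det A}\right|.$$
   Context: $SL(n)$ is the set of real $n\times n$ matrices $B$ with $\det B=1$. $|\cdot|$ denotes the Frobenius (Euclidean) norm on real $n\times n$ matrices, and $\operatorname{dist}$ is the distance with respect to this norm. *)

theory Defs
  imports "HOL-Analysis.Analysis"
begin

definition SL :: "(real ^ 'n ^ 'n) set" where
  "SL = {B. det B = 1}"

(* The library norm on real ^ 'n ^ 'n is the Frobenius norm (not the operator norm),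
   so norm and infdist on this type are the notions required. *)
lemma norm_eq_frobenius:
  fixes A :: "real ^ 'n ^ 'm"
  shows "norm A = sqrt (\<Sum>i\<in>UNIV. \<Sum>j\<in>UNIV. (A $ i $ j)\<^sup>2)"
  by (simp add: norm_vec_def L2_set_def sum_nonneg)

lemma SL_nonempty: "SL \<noteq> {}"
  unfolding SL_def using det_I by blast

end

theory Submission imports Defs begin

text \<open>
  Upper bound: shifting the \<open>(j, k)\<close> entry of \<open>A\<close> by \<open>t\<close> multiplies \<open>det A\<close> by
  \<open>1 + t * (matrix_inv A) $ k $ j\<close>. Using the largest entry of the inverse, a shift of size at most
  \<open>n\<^sup>2 \<bar>1 - 1 / det A\<bar> / norm (matrix_inv A)\<close> reaches determinant 1.
  Lower bound: if \<open>det B = 1\<close>, then \<open>1 / det A = det (1 + A\<inverse> (B - A))\<close>. Either \<open>A\<inverse> (B - A)\<close> is small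
  and the Lipschitz continuity of the determinant near the identity applies, or
  \<open>norm (B - A)\<close> is at least of order \<open>1 / norm (matrix_inv A)\<close>, which is enough because
  \<open>\<theta> * \<bar>1 - 1 / det A\<bar> \<le> 1\<close>.
\<close>

lemma norm_component_le:
  fixes A :: "real ^ 'n ^ 'm"
  shows "\<bar>A $ i $ j\<bar> \<le> norm A"
  using component_le_norm_cart[of "A $ i" j] Finite_Cartesian_Product.norm_nth_le[of A i] by linarith

lemma norm_le_sum_components:
  fixes A :: "real ^ 'n ^ 'm"
  shows "norm A \<le> (\<Sum>i\<in>UNIV. \<Sum>j\<in>UNIV. \<bar>A $ i $ j\<bar>)"
proof -
  have "norm A \<le> (\<Sum>i\<in>UNIV. norm (A $ i))"
    by (simp add: norm_vec_def L2_set_le_sum)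
  also have "\<dots> \<le> (\<Sum>i\<in>UNIV. \<Sum>j\<in>UNIV. \<bar>A $ i $ j\<bar>)"
    by (intro sum_mono norm_le_l1_cart)
  finally show ?thesis .
qed

text \<open>If all \<open>n\<^sup>2\<close> entries were smaller than
  \<open>norm A / n\<^sup>2\<close> in absolute value, their absolute sum, which bounds the norm,
  would be less than \<open>norm A\<close>.\<close>

lemma exists_large_component:
  fixes A :: "real ^ 'n ^ 'n"
  obtains i j where "norm A \<le> (real CARD('n))\<^sup>2 * \<bar>A $ i $ j\<bar>"
proof -
  have "\<exists>i j. norm A \<le> (real CARD('n))\<^sup>2 * \<bar>A $ i $ j\<bar>"
  proof (rule ccontr)
    assume "\<not> ?thesis"
    then have less: "\<bar>A $ i $ j\<bar> < norm A / (real CARD('n))\<^sup>2" for i j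
      by (auto simp: not_le field_simps)
    have "norm A \<le> (\<Sum>i\<in>UNIV. \<Sum>j\<in>UNIV. \<bar>A $ i $ j\<bar>)"
      by (rule norm_le_sum_components)
    also have "\<dots> < (\<Sum>i\<in>(UNIV :: 'n set). \<Sum>j\<in>(UNIV :: 'n set). norm A / (real CARD('n))\<^sup>2)"
      by (intro sum_strict_mono less) auto
    also have "\<dots> = norm A"
      by (simp add: power2_eq_square)
    finally show False by simp
  qed
  then show thesis using that by blast
qed

lemma matrix_mul_component_le:
  fixes A :: "real ^ 'n ^ 'm" and B :: "real ^ 'p ^ 'n"
  shows "\<bar>(A ** B) $ i $ j\<bar> \<le> real CARD('n) * (norm A * norm B)"
proof -
  have "\<bar>(A ** B) $ i $ j\<bar> \<le> (\<Sum>k\<in>UNIV. \<bar>A $ i $ k\<bar> * \<bar>B $ k $ j\<bar>)"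
    unfolding matrix_matrix_mult_def by (simp flip: abs_mult)
  also have "\<dots> \<le> (\<Sum>k\<in>(UNIV :: 'n set). norm A * norm B)"
    by (intro sum_mono mult_mono norm_component_le) auto
  finally show ?thesis by simp
qed

text \<open>Dividing all factors by \<open>c\<close> brings them into the unit ball, where
  \<open>norm_prod_diff\<close> telescopes the difference of products. Keeping
  \<open>c ^ card I\<close> and a separate division by \<open>c\<close> avoids the exponent
  \<open>card I - 1\<close>.\<close>

lemma prod_diff_le:
  fixes f g :: "'a \<Rightarrow> real"
  assumes c: "c > 0"
    and "\<And>i. i \<in> I \<Longrightarrow> \<bar>f i\<bar> \<le> c" "\<And>i. i \<in> I \<Longrightarrow> \<bar>g i\<bar> \<le> c"
  shows "\<bar>prod f I - prod g I\<bar> \<le> c ^ card I * (\<Sum>i\<in>I. \<bar>f i - g i\<bar> / c)"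
proof -
  have "norm ((\<Prod>i\<in>I. f i / c) - (\<Prod>i\<in>I. g i / c)) \<le> (\<Sum>i\<in>I. norm (f i / c - g i / c))"
    using assms by (intro norm_prod_diff) auto
  also have "(\<Sum>i\<in>I. norm (f i / c - g i / c)) = (\<Sum>i\<in>I. \<bar>f i - g i\<bar> / c)"
    using c by (simp flip: diff_divide_distrib)
  also have "norm ((\<Prod>i\<in>I. f i / c) - (\<Prod>i\<in>I. g i / c)) = \<bar>prod f I - prod g I\<bar> / c ^ card I"
    using c by (simp add: prod_dividef flip: diff_divide_distrib)
  finally show ?thesis
    using c by (simp add: field_simps)
qed

text \<open>Compare the Leibniz expansions term by term: there are \<open>fact CARD('n)\<close>
  permutations, signs have absolute value 1, and \<open>prod_diff_le\<close> bounds each difference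
  of products.\<close>

lemma det_diff_le:
  fixes A B :: "real ^ 'n ^ 'n"
  assumes c: "c > 0"
    and A: "\<And>i j. \<bar>A $ i $ j\<bar> \<le> c" and B: "\<And>i j. \<bar>B $ i $ j\<bar> \<le> c"
    and AB: "\<And>i j. \<bar>A $ i $ j - B $ i $ j\<bar> \<le> e"
  shows "\<bar>det A - det B\<bar> \<le> fact CARD('n) * (c ^ CARD('n) * (real CARD('n) * (e / c)))"
proof -
  let ?P = "{p. p permutes (UNIV :: 'n set)}"
  let ?f = "\<lambda>A p. \<Prod>i\<in>UNIV. (A :: real ^ 'n ^ 'n) $ i $ p i"
  have "\<bar>det A - det B\<bar> = \<bar>\<Sum>p\<in>?P. of_int (sign p) * (?f A p - ?f B p)\<bar>"
    unfolding det_def by (simp add: sum_subtractf right_diff_distrib)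
  also have "\<dots> \<le> (\<Sum>p\<in>?P. \<bar>of_int (sign p) * (?f A p - ?f B p)\<bar>)"
    by (rule sum_abs)
  also have "\<dots> \<le> (\<Sum>p\<in>?P. c ^ CARD('n) * (real CARD('n) * (e / c)))"
  proof (rule sum_mono)
    fix p assume "p \<in> ?P"
    have "\<bar>of_int (sign p) * (?f A p - ?f B p)\<bar> = \<bar>?f A p - ?f B p\<bar>"
      by (simp add: abs_mult sign_def)
    also have "\<dots> \<le> c ^ CARD('n) * (\<Sum>i\<in>UNIV. \<bar>A $ i $ p i - B $ i $ p i\<bar> / c)"
      using c A B by (intro prod_diff_le) auto
    also have "\<dots> \<le> c ^ CARD('n) * (\<Sum>i\<in>(UNIV :: 'n set). e / c)"
      using c AB by (intro mult_left_mono sum_mono divide_right_mono) auto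
    finally show "\<bar>of_int (sign p) * (?f A p - ?f B p)\<bar> \<le> c ^ CARD('n) * (real CARD('n) * (e / c))"
      by simp
  qed
  also have "\<dots> = fact CARD('n) * (c ^ CARD('n) * (real CARD('n) * (e / c)))"
    by (simp add: card_permutations)
  finally show ?thesis .
qed

lemma det_mat_1_add_le:
  fixes M :: "real ^ 'n ^ 'n"
  assumes M: "\<And>i j. \<bar>M $ i $ j\<bar> \<le> e" and "e \<le> 1"
  shows "\<bar>det (mat 1 + M) - 1\<bar> \<le> fact CARD('n) * 2 ^ CARD('n) * real CARD('n) * e"
proof -
  have le: "\<bar>M $ i $ j\<bar> \<le> 1" for i j
    using M \<open>e \<le> 1\<close> by (rule order_trans)
  \<comment> \<open>Any entry of \<open>M\<close> forces this, since index types are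
    nonempty.\<close>
  have "0 \<le> e"
    using M[of undefined undefined] by linarith
  \<comment> \<open>The common entry bound for \<open>mat 1 + M\<close> and \<open>mat 1\<close> is
    \<open>c = 2\<close>; the resulting factor 1/2 on \<open>e\<close> is then given away.\<close>
  have "\<bar>(mat 1 + M) $ i $ j\<bar> \<le> 2" for i j
    using le[of i j] by (auto simp: mat_def)
  then have "\<bar>det (mat 1 + M) - det (mat 1 :: real ^ 'n ^ 'n)\<bar>
      \<le> fact CARD('n) * (2 ^ CARD('n) * (real CARD('n) * (e / 2)))"
    using M by (intro det_diff_le) (auto simp: mat_def)
  also have "\<dots> \<le> fact CARD('n) * (2 ^ CARD('n) * (real CARD('n) * e))"
    using \<open>0 \<le> e\<close> by (intro mult_left_mono) auto
  finally show ?thesis by (simp add: mult.assoc)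
qed

lemma matrix_inv_right:
  fixes A :: "real ^ 'n ^ 'n"
  assumes "invertible A"
  shows "A ** matrix_inv A = mat 1"
  using assms unfolding invertible_def matrix_inv_def by (rule someI2_ex) simp

text \<open>The shift adds \<open>t\<close> times the \<open>j\<close>-th unit vector to column
  \<open>k\<close>, so the new column is \<open>A *v x\<close> for the \<open>x\<close> below.
  Cramer's rule then gives the determinant \<open>x $ k * det A\<close>.\<close>

lemma det_add_axis:
  fixes A :: "real ^ 'n ^ 'n"
  assumes "invertible A"
  shows "det (A + axis j (axis k t)) = (1 + t * matrix_inv A $ k $ j) * det A"
proof -
  define x where "x = axis k 1 + t *\<^sub>R (matrix_inv A *v axis j 1)"
  have "A *v x = A *v axis k 1 + t *\<^sub>R ((A ** matrix_inv A) *v axis j 1)"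
    by (simp add: x_def matrix_vector_right_distrib matrix_vector_mult_scaleR
        matrix_vector_mul_assoc)
  also have "A ** matrix_inv A = mat 1"
    using assms by (rule matrix_inv_right)
  finally have Ax: "A *v x = column k A + t *\<^sub>R axis j 1"
    by (simp only: matrix_vector_mult_basis[of A] matrix_vector_mul_lid)
  have "A + axis j (axis k t) = (\<chi> i l. if l = k then (A *v x) $ i else A $ i $ l)"
    by (auto simp: vec_eq_iff Ax column_def axis_def)
  then have "det (A + axis j (axis k t)) = x $ k * det A"
    by (simp add: cramer_lemma)
  moreover have "x $ k = 1 + t * matrix_inv A $ k $ j"
    by (simp add: x_def matrix_vector_mult_basis column_def)
  ultimately show ?thesis by simp
qed

lemma norm_axis_eq: "norm (axis i x) = norm x"
proof -
  have "(\<Sum>j\<in>UNIV. (norm (axis i x $ j))\<^sup>2) = (\<Sum>j\<in>UNIV. if j = i then (norm x)\<^sup>2 else 0)"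
    by (intro sum.cong) (auto simp: axis_def)
  then show ?thesis by (simp add: norm_vec_def L2_set_def)
qed

lemma infdist_SL_le:
  fixes A :: "real ^ 'n ^ 'n"
  assumes "det A \<noteq> 0"
  shows "infdist A SL \<le> (real CARD('n))\<^sup>2 * (1 / norm (matrix_inv A)) * \<bar>1 - 1 / det A\<bar>"
proof -
  have inv: "invertible A" using assms by (simp add: invertible_det_nz)
  have "det A * det (matrix_inv A) = 1"
    by (simp add: matrix_inv_right[OF inv] flip: det_mul)
  moreover have "det (0 :: real ^ 'n ^ 'n) = 0"
    using det_0 by (simp add: mat_def vec_eq_iff zero_vec_def)
  ultimately have "matrix_inv A \<noteq> 0" by auto
  then have pos: "norm (matrix_inv A) > 0" by simp
  \<comment> \<open>The indices appear transposed: entry \<open>(k, j)\<close> of the inverse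
    governs a shift of entry \<open>(j, k)\<close> of \<open>A\<close>.\<close>
  obtain k j where kj: "norm (matrix_inv A) \<le> (real CARD('n))\<^sup>2 * \<bar>matrix_inv A $ k $ j\<bar>"
    using exists_large_component .
  define a where "a = matrix_inv A $ k $ j"
  have "a \<noteq> 0" using kj pos by (auto simp: a_def)
  \<comment> \<open>The solution of \<open>(1 + t * a) * det A = 1\<close>.\<close>
  define t where "t = (1 / det A - 1) / a"
  have "det (A + axis j (axis k t)) = 1"
    using \<open>a \<noteq> 0\<close> assms by (simp add: det_add_axis[OF inv] t_def flip: a_def)
  then have "infdist A SL \<le> dist A (A + axis j (axis k t))"
    by (intro infdist_le) (simp add: SL_def)
  also have "\<dots> = \<bar>t\<bar>"
    by (simp add: dist_norm norm_axis_eq)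
  also have "\<dots> = 1 / \<bar>a\<bar> * \<bar>1 - 1 / det A\<bar>"
    by (simp add: t_def abs_minus_commute)
  also have "\<dots> \<le> (real CARD('n))\<^sup>2 * (1 / norm (matrix_inv A)) * \<bar>1 - 1 / det A\<bar>"
    using kj pos \<open>a \<noteq> 0\<close> by (intro mult_right_mono) (auto simp: a_def field_simps)
  finally show ?thesis .
qed

lemma dist_SL_ge:
  fixes A B :: "real ^ 'n ^ 'n"
  assumes "0 < \<theta>" "\<theta> \<le> 1 / 2" "\<theta> \<le> det A" and B: "det B = 1"
    and K: "K = max 1 (fact CARD('n) * 2 ^ CARD('n) * real CARD('n))"
  shows "\<theta> * \<bar>1 - 1 / det A\<bar> \<le> K * (real CARD('n) * (norm (matrix_inv A) * dist A B))"
proof -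
  \<comment> \<open>By \<open>matrix_mul_component_le\<close>, \<open>e\<close> bounds every entry
    of the matrix \<open>M\<close> below; whether \<open>e \<le> 1\<close> separates the near case
    from the far case.\<close>
  define e where "e = real CARD('n) * (norm (matrix_inv A) * norm (B - A))"
  have "e \<ge> 0" by (simp add: e_def)
  have inv: "invertible A" using assms by (simp add: invertible_det_nz)
  define M where "M = matrix_inv A ** (B - A)"
  have "A ** (mat 1 + M) = A + (A ** matrix_inv A) ** (B - A)"
    by (simp add: M_def matrix_add_ldistrib matrix_mul_assoc)
  then have "A ** (mat 1 + M) = B"
    by (simp add: matrix_inv_right[OF inv])
  then have "det A * det (mat 1 + M) = 1"
    using B by (simp flip: det_mul)
  then have det: "det (mat 1 + M) = 1 / det A"
    using assms by (auto simp: field_simps)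
  have "\<theta> * \<bar>1 - 1 / det A\<bar> \<le> K * e"
  proof (cases "e \<le> 1")
    case True
    have M: "\<bar>M $ i $ j\<bar> \<le> e" for i j
      unfolding M_def e_def by (rule matrix_mul_component_le)
    have "\<theta> * \<bar>1 - 1 / det A\<bar> \<le> 1 * \<bar>1 - 1 / det A\<bar>"
      using assms by (intro mult_right_mono) auto
    also have "\<dots> = \<bar>det (mat 1 + M) - 1\<bar>"
      by (simp add: det)
    also have "\<dots> \<le> fact CARD('n) * 2 ^ CARD('n) * real CARD('n) * e"
      using M True by (rule det_mat_1_add_le)
    also have "\<dots> \<le> K * e"
      using \<open>e \<ge> 0\<close> by (intro mult_right_mono) (auto simp: K)
    finally show ?thesis .
  next
    case False
    \<comment> \<open>Both \<open>\<theta>\<close> and \<open>\<theta> / det A\<close> lie between 0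
      and 1, so they differ by at most 1, while \<open>K * e\<close> exceeds 1 here.\<close>
    have "\<theta> * (1 / det A) \<le> 1" "0 \<le> \<theta> * (1 / det A)"
      using assms by auto
    then have "\<bar>\<theta> - \<theta> * (1 / det A)\<bar> \<le> 1"
      using assms by linarith
    moreover have "\<bar>\<theta> - \<theta> * (1 / det A)\<bar> = \<theta> * \<bar>1 - 1 / det A\<bar>"
      using \<open>0 < \<theta>\<close> abs_mult[of \<theta> "1 - 1 / det A"] by (simp add: right_diff_distrib)
    ultimately have "\<theta> * \<bar>1 - 1 / det A\<bar> \<le> 1" by simp
    also have "1 \<le> K * e"
      using False mult_mono[of 1 K 1 e] by (simp add: K)
    finally show ?thesis .
  qed
  then show ?thesis by (simp add: e_def dist_norm norm_minus_commute)
qed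

theorem corollary3p6:
  "\<exists>C>0. \<forall>\<theta> (A :: real ^ 'n ^ 'n). 0 < \<theta> \<and> \<theta> \<le> 1/2 \<and> \<theta> \<le> det A \<longrightarrow>
     \<theta> / C * (1 / norm (matrix_inv A)) * \<bar>1 - 1 / det A\<bar> \<le> infdist A SL \<and>
     infdist A SL \<le> C * (1 / norm (matrix_inv A)) * \<bar>1 - 1 / det A\<bar>"
proof -
  define n where "n = real CARD('n)"
  define K where "K = max 1 (fact CARD('n) * 2 ^ CARD('n) * real CARD('n))"
  \<comment> \<open>The lower bound needs \<open>K * n\<close> and the upper bound
    \<open>n\<^sup>2\<close>; as \<open>K\<close> and \<open>n\<close> are at least 1,
    \<open>K * n\<^sup>2\<close> dominates both.\<close>
  define C where "C = K * n\<^sup>2"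
  have n: "n \<ge> 1" by (simp add: n_def Suc_le_eq)
  have K: "K \<ge> 1" by (simp add: K_def)
  have C: "C > 0" using n K by (simp add: C_def)
  have CK: "K * n \<le> C"
    using n K by (simp add: C_def power2_eq_square)
  have Cn: "n\<^sup>2 \<le> C"
    using n K by (simp add: C_def)
  show ?thesis
  proof (intro exI conjI allI impI; (elim conjE)?)
    show "C > 0" by (rule C)
  next
    fix \<theta> and A :: "real ^ 'n ^ 'n"
    assume \<theta>: "0 < \<theta>" "\<theta> \<le> 1/2" "\<theta> \<le> det A"
    let ?N = "norm (matrix_inv A)"
    have "\<theta> / C * (1 / ?N) * \<bar>1 - 1 / det A\<bar> \<le> dist A B" if "B \<in> SL" for B
    \<comment> \<open>If \<open>?N = 0\<close>, the convention \<open>1 / 0 = 0\<close> makes the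
      left side vanish.\<close>
    proof (cases "?N = 0")
      case False
      have "\<theta> * \<bar>1 - 1 / det A\<bar> \<le> K * n * (?N * dist A B)"
        using dist_SL_ge[OF \<theta>, of B K] that by (simp add: SL_def K_def n_def mult.assoc)
      also have "\<dots> \<le> C * (?N * dist A B)"
        using CK by (intro mult_right_mono) auto
      finally show ?thesis
        using C False by (simp add: field_simps)
    qed simp
    then show "\<theta> / C * (1 / ?N) * \<bar>1 - 1 / det A\<bar> \<le> infdist A SL"
      \<comment> \<open>The bound holds for each \<open>B\<close> in \<open>SL\<close>, hence for
        the infimum of the distances over this nonempty set.\<close>
      using SL_nonempty by (auto simp: infdist_def intro: cINF_greatest)
    have "infdist A SL \<le> n\<^sup>2 * (1 / ?N) * \<bar>1 - 1 / det A\<bar>"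
      using infdist_SL_le[of A] \<theta> by (simp add: n_def)
    also have "\<dots> \<le> C * (1 / ?N) * \<bar>1 - 1 / det A\<bar>"
      using Cn by (intro mult_right_mono) auto
    finally show "infdist A SL \<le> C * (1 / ?N) * \<bar>1 - 1 / det A\<bar>" .
  qed
qed

end
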